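(* The rules $i{\uparrow}$, $w{\uparrow}$ and $c{\uparrow}$ are admissible for system $\mathsf{KSg}$.
   Context: Structures: generated by $S ::= \mathsf f \mid \mathsf t \mid a \mid [S,\dots,S] \mid (S,\dots,S) \mid \bar S$ (non-empty lists), where $a$ ranges over atoms, $\mathsf f,\mathsf t$ are the units false and true, $[\cdot]$ is disjunction, $(\cdot)$ is conjunction, $\bar S$ is negation; the negation of an atom is again an atom. A context $S\{\ \}$ is a structure with one occurrence of a hole, not in the scope of a negation; $S\{R\}$ is the result of filling it with $R$; $S[R,T]$ abbreviates $S\{[R,T]\}$ and $S(R,T)$ abbreviates $S\{(R,T)\}$. Equivalent structures are not distinguished; equivalence is the smallest equivalence relation induced by: $[\vec R,[\vec T],\vec U]=[\vec R,\vec T,\vec U]$ and $(\vec R,(\vec T),\vec U)=(\vec R,\vec T,\vec U)$ (with $\vec R,\vec T,\vec U$ finite sequences, $\vec T$ non-empty); $[R,T]=[T,R]$, $(R,T)=(T,R)$; $(\mathsf f,\mathsf f)=\mathsf f$, $[\mathsf f,R]=R$, $[\mathsf t,\mathsf t]=\mathsf t$, $(\mathsf t,R)=R$; $\bar{\mathsf f}=\mathsf t$, $\bar{\mathsf t}=\mathsf f$, $\overline{[R,T]}=(\bar R,\bar T)$, $\overline{(R,T)}=[\bar R,\bar T]$, $\bar{\bar R}=R$; and closure: if $R=T$ then $S\{R\}=S\{T\}$ and $\bar R=\bar T$. A derivation in a system (set of inference rules) is a finite sequence of rule instances, read top-down, the conclusion of each being the premise of the next; it may consist of a single structure. A proof of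 $R$ is a derivation with premise $\mathsf t$ and conclusion $R$. Rules (written $\frac{\text{premise}}{\text{conclusion}}$, for arbitrary structures $R,T,U$ and contexts $S\{\ \}$): $i{\downarrow}:\frac{S\{\mathsf t\}}{S[R,\bar R]}$, $i{\uparrow}$ (cut)$:\frac{S(R,\bar R)}{S\{\mathsf f\}}$, $s:\frac{S([R,U],T)}{S[(R,T),U]}$, $w{\downarrow}:\frac{S\{\mathsf f\}}{S\{R\}}$, $w{\uparrow}:\frac{S\{R\}}{S\{\mathsf t\}}$, $c{\downarrow}:\frac{S[R,R]}{S\{R\}}$, $c{\uparrow}:\frac{S\{R\}}{S(R,R)}$. System $\mathsf{KSg}$ is $\{i{\downarrow},s,w{\downarrow},c{\downarrow}\}$. A rule $\rho$ is admissible for a system $\mathcal S$ if for every proof of a structure in $\mathcal S\cup\{\rho\}$ there is a proof of the same structure in $\mathcal S$. *)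

theory Defs
  imports Main
begin

text \<open>
  Atoms come in complementary pairs over an arbitrary type of propositional variables, so that
  negation is a fixed-point-free involution on atoms.
\<close>

datatype 'v atom = Pos 'v | Neg 'v

primrec atom_neg :: "'v atom \<Rightarrow> 'v atom" where
  "atom_neg (Pos v) = Neg v"
| "atom_neg (Neg v) = Pos v"

text \<open>
  Structures as expressions, before equivalent ones are identified. The lists in disjunctions and
  conjunctions are non-empty: the constructors take head and tail separately, while \<open>disj_list\<close> and
  \<open>conj_list\<close> below take the whole list (they are unspecified on the empty list and only ever applied
  to non-empty ones).
\<close>

datatype 'v expr =
    FF
  | TT
  | Atom "'v atom"
  | Disj "'v expr" "'v expr list"
  | Conj "'v expr" "'v expr list"
  | Bar "'v expr"

fun disj_list :: "'v expr list \<Rightarrow> 'v expr" where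
  "disj_list (R # Rs) = Disj R Rs"

fun conj_list :: "'v expr list \<Rightarrow> 'v expr" where
  "conj_list (R # Rs) = Conj R Rs"

text \<open>There is no constructor for negation: the hole may not be in the scope of a negation.\<close>

datatype 'v ctxt =
    Hole
  | CDisj "'v expr list" "'v ctxt" "'v expr list"
  | CConj "'v expr list" "'v ctxt" "'v expr list"

primrec fill :: "'v ctxt \<Rightarrow> 'v expr \<Rightarrow> 'v expr" where
  "fill Hole R = R"
| "fill (CDisj Rs S Us) R = disj_list (Rs @ [fill S R] @ Us)"
| "fill (CConj Rs S Us) R = conj_list (Rs @ [fill S R] @ Us)"

text \<open>
  The rule \<open>neg_atom\<close> expresses that the negation of an atom is again an atom.
\<close>

inductive eqv :: "'v expr \<Rightarrow> 'v expr \<Rightarrow> bool" where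
  refl: "eqv R R"
| sym: "eqv R T \<Longrightarrow> eqv T R"
| trans: "eqv R T \<Longrightarrow> eqv T U \<Longrightarrow> eqv R U"
| assoc_disj: "Ts \<noteq> [] \<Longrightarrow> eqv (disj_list (Rs @ [disj_list Ts] @ Us)) (disj_list (Rs @ Ts @ Us))"
| assoc_conj: "Ts \<noteq> [] \<Longrightarrow> eqv (conj_list (Rs @ [conj_list Ts] @ Us)) (conj_list (Rs @ Ts @ Us))"
| comm_disj: "eqv (disj_list [R, T]) (disj_list [T, R])"
| comm_conj: "eqv (conj_list [R, T]) (conj_list [T, R])"
| unit_FF_conj: "eqv (conj_list [FF, FF]) FF"
| unit_FF_disj: "eqv (disj_list [FF, R]) R"
| unit_TT_disj: "eqv (disj_list [TT, TT]) TT"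
| unit_TT_conj: "eqv (conj_list [TT, R]) R"
| neg_FF: "eqv (Bar FF) TT"
| neg_TT: "eqv (Bar TT) FF"
| neg_atom: "eqv (Bar (Atom a)) (Atom (atom_neg a))"
| neg_disj: "eqv (Bar (disj_list [R, T])) (conj_list [Bar R, Bar T])"
| neg_conj: "eqv (Bar (conj_list [R, T])) (disj_list [Bar R, Bar T])"
| neg_neg: "eqv (Bar (Bar R)) R"
| cong_ctxt: "eqv R T \<Longrightarrow> eqv (fill S R) (fill S T)"
| cong_neg: "eqv R T \<Longrightarrow> eqv (Bar R) (Bar T)"

quotient_type 'v struct = "'v expr" / eqv
  morphisms rep_struct cls
  by (rule equivpI) (auto intro: reflpI sympI transpI eqv.refl eqv.sym eqv.trans)

text \<open>A rule is the set of its instances, as pairs of premise and conclusion.\<close>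

type_synonym 'v rule = "('v struct \<times> 'v struct) set"

definition i_down :: "'v rule" where
  "i_down = {(cls (fill S TT), cls (fill S (disj_list [R, Bar R]))) | S R. True}"

definition i_up :: "'v rule" where
  "i_up = {(cls (fill S (conj_list [R, Bar R])), cls (fill S FF)) | S R. True}"

definition switch :: "'v rule" where
  "switch = {(cls (fill S (conj_list [disj_list [R, U], T])), cls (fill S (disj_list [conj_list [R, T], U]))) | S R T U. True}"

definition w_down :: "'v rule" where
  "w_down = {(cls (fill S FF), cls (fill S R)) | S R. True}"

definition w_up :: "'v rule" where
  "w_up = {(cls (fill S R), cls (fill S TT)) | S R. True}"

definition c_down :: "'v rule" where
  "c_down = {(cls (fill S (disj_list [R, R])), cls (fill S R)) | S R. True}"

definition c_up :: "'v rule" where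
  "c_up = {(cls (fill S R), cls (fill S (conj_list [R, R]))) | S R. True}"

definition KSg :: "'v rule set" where
  "KSg = {i_down, switch, w_down, c_down}"

text \<open>A derivation is given by the list of its structures, from top to bottom.\<close>

definition derivation :: "'v rule set \<Rightarrow> 'v struct list \<Rightarrow> bool" where
  "derivation \<S> D \<longleftrightarrow>
     D \<noteq> [] \<and> (\<forall>i. Suc i < length D \<longrightarrow> (\<exists>\<rho>\<in>\<S>. (D ! i, D ! Suc i) \<in> \<rho>))"

definition proof_of :: "'v rule set \<Rightarrow> 'v struct list \<Rightarrow> 'v struct \<Rightarrow> bool" where
  "proof_of \<S> D R \<longleftrightarrow> derivation \<S> D \<and> hd D = cls TT \<and> last D = R"

definition admissible :: "'v rule \<Rightarrow> 'v rule set \<Rightarrow> bool" where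
  "admissible \<rho> \<S> \<longleftrightarrow>
     (\<forall>D R. proof_of (\<S> \<union> {\<rho>}) D R \<longrightarrow> (\<exists>D'. proof_of \<S> D' R))"

end

theory Submission
  imports Defs
begin

text \<open>
  The up-rules are sound for the classical Boolean semantics, so it suffices that \<open>KSg\<close> proves every
  valid structure. Read from bottom to top, switch and contraction distribute disjunction over
  conjunction and thereby reduce a structure to the clauses that it entails; a valid clause
  contains a complementary pair of atoms and is proved by \<open>i_down\<close> and weakening.
\<close>

section \<open>Equivalence of binary structures\<close>

abbreviation disj2 :: "'v expr \<Rightarrow> 'v expr \<Rightarrow> 'v expr" where
  "disj2 A B \<equiv> Disj A [B]"

abbreviation conj2 :: "'v expr \<Rightarrow> 'v expr \<Rightarrow> 'v expr" where
  "conj2 A B \<equiv> Conj A [B]"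

declare eqv.trans [trans]

lemmas eqv_disj2_commute = eqv.comm_disj [simplified]
lemmas eqv_conj2_commute = eqv.comm_conj [simplified]
lemmas eqv_disj2_FF = eqv.unit_FF_disj [simplified]
lemmas eqv_conj2_TT = eqv.unit_TT_conj [simplified]

lemma eqv_disj2_cong_left: "eqv A B \<Longrightarrow> eqv (disj2 A C) (disj2 B C)"
  using eqv.cong_ctxt [of A B "CDisj [] Hole [C]"] by simp

lemma eqv_disj2_cong_right: "eqv A B \<Longrightarrow> eqv (disj2 C A) (disj2 C B)"
  using eqv.cong_ctxt [of A B "CDisj [C] Hole []"] by simp

lemma eqv_Disj_Cons: "eqv (Disj A (B # Bs)) (disj2 A (Disj B Bs))"
  using eqv.assoc_disj [of "B # Bs" "[A]" "[]", THEN eqv.sym] by simp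

lemma eqv_Conj_Cons: "eqv (Conj A (B # Bs)) (conj2 A (Conj B Bs))"
  using eqv.assoc_conj [of "B # Bs" "[A]" "[]", THEN eqv.sym] by simp

text \<open>No generating rule mentions one-element lists. Associativity removes the inner singleton
  only inside a longer list, so a unit \<open>FF\<close> is added first and dropped
  afterwards.\<close>

lemma eqv_Disj_Nil: "eqv (Disj A []) A"
proof -
  have "eqv (Disj A []) (disj2 FF (Disj A []))"
    by (rule eqv.sym [OF eqv_disj2_FF])
  also have "eqv (disj2 FF (Disj A [])) (disj2 FF A)"
    by (rule eqv.sym [OF eqv_Disj_Cons])
  also have "eqv (disj2 FF A) A"
    by (rule eqv_disj2_FF)
  finally show ?thesis .
qed

lemma eqv_Conj_Nil: "eqv (Conj A []) A"
proof -
  have "eqv (Conj A []) (conj2 TT (Conj A []))"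
    by (rule eqv.sym [OF eqv_conj2_TT])
  also have "eqv (conj2 TT (Conj A [])) (conj2 TT A)"
    by (rule eqv.sym [OF eqv_Conj_Cons])
  also have "eqv (conj2 TT A) A"
    by (rule eqv_conj2_TT)
  finally show ?thesis .
qed

lemma eqv_disj2_assoc: "eqv (disj2 (disj2 A B) C) (disj2 A (disj2 B C))"
proof -
  have "eqv (disj2 (disj2 A B) C) (Disj A [B, C])"
    using eqv.assoc_disj [of "[A, B]" "[]" "[C]"] by simp
  also have "eqv (Disj A [B, C]) (disj2 A (disj2 B C))"
    by (rule eqv_Disj_Cons)
  finally show ?thesis .
qed

lemma eqv_disj2_left_commute: "eqv (disj2 A (disj2 B C)) (disj2 B (disj2 A C))"
  by (meson eqv.sym eqv.trans eqv_disj2_assoc eqv_disj2_commute eqv_disj2_cong_left)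

lemma eqv_disj2_FF_right: "eqv (disj2 A FF) A"
  by (meson eqv.trans eqv_disj2_commute eqv_disj2_FF)

section \<open>Soundness\<close>

fun atom_eval :: "('v \<Rightarrow> bool) \<Rightarrow> 'v atom \<Rightarrow> bool" where
  "atom_eval v (Pos p) = v p"
| "atom_eval v (Neg p) = (\<not> v p)"

fun eval :: "('v \<Rightarrow> bool) \<Rightarrow> 'v expr \<Rightarrow> bool" where
  "eval v FF = False"
| "eval v TT = True"
| "eval v (Atom a) = atom_eval v a"
| "eval v (Disj R Rs) = (eval v R \<or> (\<exists>T\<in>set Rs. eval v T))"
| "eval v (Conj R Rs) = (eval v R \<and> (\<forall>T\<in>set Rs. eval v T))"
| "eval v (Bar R) = (\<not> eval v R)"

lemma eval_disj_list: "Rs \<noteq> [] \<Longrightarrow> eval v (disj_list Rs) = (\<exists>T\<in>set Rs. eval v T)"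
  by (cases Rs) auto

lemma eval_conj_list: "Rs \<noteq> [] \<Longrightarrow> eval v (conj_list Rs) = (\<forall>T\<in>set Rs. eval v T)"
  by (cases Rs) auto

lemma atom_eval_atom_neg: "atom_eval v (atom_neg a) = (\<not> atom_eval v a)"
  by (cases a) auto

text \<open>The hole never lies under a negation, so contexts are monotone. The implication is
  needed only at the given valuation \<open>v\<close>.\<close>

lemma eval_fill_mono:
  "(eval v R \<Longrightarrow> eval v T) \<Longrightarrow> eval v (fill S R) \<Longrightarrow> eval v (fill S T)"
  by (induction S) (auto simp: eval_disj_list eval_conj_list)

lemma eqv_imp_eval_eq: "eqv R T \<Longrightarrow> eval v R = eval v T"
proof (induction rule: eqv.induct)
  case (cong_ctxt R T S)
  \<comment> \<open>Monotonicity applied in both directions turns equal truth values in the hole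
    into equal truth values of the filled contexts.\<close>
  then show ?case by (metis eval_fill_mono)
qed (auto simp: eval_disj_list eval_conj_list atom_eval_atom_neg)

lift_definition struct_eval :: "('v \<Rightarrow> bool) \<Rightarrow> 'v struct \<Rightarrow> bool" is eval
  by (rule eqv_imp_eval_eq)

lemma struct_eval_fill_mono:
  "(eval v R \<Longrightarrow> eval v T) \<Longrightarrow> struct_eval v (cls (fill S R)) \<Longrightarrow> struct_eval v (cls (fill S T))"
  unfolding struct_eval.abs_eq by (rule eval_fill_mono)

definition sound :: "'v rule \<Rightarrow> bool" where
  "sound \<rho> \<longleftrightarrow> (\<forall>(X, Y)\<in>\<rho>. \<forall>v. struct_eval v X \<longrightarrow> struct_eval v Y)"

lemma sound_KSg: "\<rho> \<in> KSg \<Longrightarrow> sound \<rho>"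
  unfolding KSg_def i_down_def switch_def w_down_def c_down_def sound_def
  by (auto elim!: struct_eval_fill_mono [rotated])

lemma sound_up: "sound i_up" "sound w_up" "sound c_up"
  unfolding i_up_def w_up_def c_up_def sound_def
  by (auto elim!: struct_eval_fill_mono [rotated])

lemma derivation_sound:
  assumes "derivation \<S> D" and "\<And>\<rho>. \<rho> \<in> \<S> \<Longrightarrow> sound \<rho>" and "struct_eval v (hd D)"
  shows "struct_eval v (last D)"
proof -
  have "struct_eval v (D ! i)" if "i < length D" for i
    using that
  proof (induction i)
    case 0
    then show ?case using assms(3) by (simp add: hd_conv_nth)
  next
    case (Suc i)
    then obtain \<rho> where "\<rho> \<in> \<S>" "(D ! i, D ! Suc i) \<in> \<rho>"
      using assms(1) unfolding derivation_def by blast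
    with Suc assms(2) show ?case unfolding sound_def by fastforce
  qed
  then show ?thesis
    using assms(1) by (simp add: derivation_def last_conv_nth)
qed

section \<open>Derivability in KSg\<close>

text \<open>Reachability under the union of the rules composes more easily than lists of structures;
  the lists are recovered only here.\<close>

lemma derivation_of_rtrancl:
  assumes "(X, Y) \<in> (\<Union>\<S>)\<^sup>*"
  shows "\<exists>D. derivation \<S> D \<and> hd D = X \<and> last D = Y"
  using assms
proof (induction rule: rtrancl_induct)
  case base
  then show ?case by (intro exI [of _ "[X]"]) (simp add: derivation_def)
next
  case (step Y Z)
  then obtain D \<rho> where D: "derivation \<S> D" "hd D = X" "last D = Y"
    and \<rho>: "\<rho> \<in> \<S>" "(Y, Z) \<in> \<rho>" by blast
  have "\<exists>\<rho>\<in>\<S>. ((D @ [Z]) ! i, (D @ [Z]) ! Suc i) \<in> \<rho>" if "Suc i < length (D @ [Z])" for i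
  proof (cases "Suc i < length D")
    case True
    then show ?thesis using D(1) by (simp add: derivation_def nth_append)
  next
    case False
    \<comment> \<open>The one new rule instance is at the seam, from the last structure of
      \<open>D\<close> to the appended \<open>Z\<close>.\<close>
    with that have "length D = Suc i" by simp
    then have "D ! i = Y" using D(3) by (cases D) (auto simp: last_conv_nth)
    with \<open>length D = Suc i\<close> \<rho> show ?thesis by (auto simp: nth_append)
  qed
  with D show ?case
    by (intro exI [of _ "D @ [Z]"]) (simp add: derivation_def)
qed

section \<open>Derivability inside arbitrary contexts\<close>

primrec ctxt_comp :: "'v ctxt \<Rightarrow> 'v ctxt \<Rightarrow> 'v ctxt" where
  "ctxt_comp Hole S' = S'"
| "ctxt_comp (CDisj Rs S Us) S' = CDisj Rs (ctxt_comp S S') Us"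
| "ctxt_comp (CConj Rs S Us) S' = CConj Rs (ctxt_comp S S') Us"

lemma fill_ctxt_comp: "fill (ctxt_comp S S') R = fill S (fill S' R)"
  by (induction S) auto

text \<open>Quantifying over all contexts builds in closure under contexts, since an outer and an
  inner context compose to one context.\<close>

definition derives :: "'v expr \<Rightarrow> 'v expr \<Rightarrow> bool" where
  "derives A B \<longleftrightarrow> (\<forall>S. (cls (fill S A), cls (fill S B)) \<in> (\<Union>KSg)\<^sup>*)"

lemma derives_trans [trans]: "derives A B \<Longrightarrow> derives B C \<Longrightarrow> derives A C"
  unfolding derives_def by (meson rtrancl_trans)

lemma eqv_imp_derives: "eqv A B \<Longrightarrow> derives A B"
proof -
  assume "eqv A B"
  then have "cls (fill S A) = cls (fill S B)" for S
    using eqv.cong_ctxt by (simp add: struct.abs_eq_iff)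
  then show ?thesis by (simp add: derives_def)
qed

lemma derives_eqv_trans [trans]: "derives A B \<Longrightarrow> eqv B C \<Longrightarrow> derives A C"
  by (rule derives_trans [OF _ eqv_imp_derives])

lemma eqv_derives_trans [trans]: "eqv A B \<Longrightarrow> derives B C \<Longrightarrow> derives A C"
  by (rule derives_trans [OF eqv_imp_derives])

lemma derives_fill: "derives A B \<Longrightarrow> derives (fill S A) (fill S B)"
  unfolding derives_def by (metis fill_ctxt_comp)

lemma derives_i_down: "derives TT (disj2 R (Bar R))"
  unfolding derives_def KSg_def i_down_def by (fastforce intro!: r_into_rtrancl)

lemma derives_switch: "derives (conj2 (disj2 R U) T) (disj2 (conj2 R T) U)"
  unfolding derives_def KSg_def switch_def by (fastforce intro!: r_into_rtrancl)

lemma derives_w_down: "derives FF R"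
  unfolding derives_def KSg_def w_down_def by (fastforce intro!: r_into_rtrancl)

lemma derives_c_down: "derives (disj2 R R) R"
  unfolding derives_def KSg_def c_down_def by (fastforce intro!: r_into_rtrancl)

lemma derives_disj2_left: "derives A B \<Longrightarrow> derives (disj2 A C) (disj2 B C)"
  using derives_fill [of A B "CDisj [] Hole [C]"] by simp

lemma derives_disj2_right: "derives A B \<Longrightarrow> derives (disj2 C A) (disj2 C B)"
  using derives_fill [of A B "CDisj [C] Hole []"] by simp

lemma derives_conj2_left: "derives A B \<Longrightarrow> derives (conj2 A C) (conj2 B C)"
  using derives_fill [of A B "CConj [] Hole [C]"] by simp

lemma derives_conj2_right: "derives A B \<Longrightarrow> derives (conj2 C A) (conj2 C B)"
  using derives_fill [of A B "CConj [C] Hole []"] by simp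

text \<open>\<open>A\<close> is equivalent to its disjunction with \<open>FF\<close>, and weakening
  turns this \<open>FF\<close> into \<open>B\<close>.\<close>

lemma derives_disj2_intro_left: "derives A (disj2 A B)"
  by (meson derives_disj2_right derives_w_down eqv.sym eqv_derives_trans eqv_disj2_FF_right)

lemma derives_disj2_intro_right: "derives B (disj2 A B)"
  by (meson derives_disj2_intro_left derives_eqv_trans eqv_disj2_commute)

lemma derives_TT_conj2:
  assumes "derives TT A" "derives TT B"
  shows "derives TT (conj2 A B)"
proof -
  have "eqv TT (conj2 TT TT)" by (rule eqv.sym [OF eqv_conj2_TT])
  also have "derives (conj2 TT TT) (conj2 A TT)" using assms(1) by (rule derives_conj2_left)
  also have "derives (conj2 A TT) (conj2 A B)" using assms(2) by (rule derives_conj2_right)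
  finally show ?thesis .
qed

text \<open>Two switches move the two copies of \<open>C\<close> out of the conjunction, and
  contraction merges them.\<close>

lemma derives_distrib: "derives (conj2 (disj2 A C) (disj2 B C)) (disj2 (conj2 A B) C)"
proof -
  have "derives (conj2 (disj2 A C) (disj2 B C)) (disj2 (conj2 A (disj2 B C)) C)"
    by (rule derives_switch)
  also have "eqv (disj2 (conj2 A (disj2 B C)) C) (disj2 (conj2 (disj2 B C) A) C)"
    by (rule eqv_disj2_cong_left [OF eqv_conj2_commute])
  also have "derives (disj2 (conj2 (disj2 B C) A) C) (disj2 (disj2 (conj2 B A) C) C)"
    by (rule derives_disj2_left [OF derives_switch])
  also have "eqv (disj2 (disj2 (conj2 B A) C) C) (disj2 (conj2 B A) (disj2 C C))"
    by (rule eqv_disj2_assoc)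
  also have "derives (disj2 (conj2 B A) (disj2 C C)) (disj2 (conj2 B A) C)"
    by (rule derives_disj2_right [OF derives_c_down])
  also have "eqv (disj2 (conj2 B A) C) (disj2 (conj2 A B) C)"
    by (rule eqv_disj2_cong_left [OF eqv_conj2_commute])
  finally show ?thesis .
qed

section \<open>Completeness\<close>

text \<open>Ending in the unit \<open>FF\<close> provides an empty clause and lets concatenation of
  lists correspond to disjunction without case distinctions.\<close>

primrec clause :: "'v atom list \<Rightarrow> 'v expr" where
  "clause [] = FF"
| "clause (a # K) = disj2 (Atom a) (clause K)"

lemma eval_clause: "eval v (clause K) \<longleftrightarrow> (\<exists>a\<in>set K. atom_eval v a)"
  by (induction K) auto

lemma eqv_clause_append: "eqv (clause (K @ L)) (disj2 (clause K) (clause L))"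
proof (induction K)
  case Nil
  then show ?case using eqv.sym [OF eqv_disj2_FF] by simp
next
  case (Cons a K)
  then show ?case
    by simp (meson eqv.sym eqv.trans eqv_disj2_assoc eqv_disj2_cong_right)
qed

lemma derives_Atom_clause: "a \<in> set K \<Longrightarrow> derives (Atom a) (clause K)"
proof (induction K)
  case (Cons b K)
  show ?case
  proof (cases "a = b")
    case True
    then show ?thesis by (simp add: derives_disj2_intro_left)
  next
    case False
    with Cons have "derives (Atom a) (clause K)" by simp
    then show ?thesis by simp (meson derives_disj2_intro_right derives_trans)
  qed
qed simp

lemma derives_TT_clause:
  assumes "\<And>v. eval v (clause K)"
  shows "derives TT (clause K)"
proof -
  \<comment> \<open>This valuation falsifies every negative literal of \<open>K\<close>. The literal
    that it satisfies must therefore be positive, and its variable also occurs negatively in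
    \<open>K\<close>.\<close>
  obtain a where "a \<in> set K" and "atom_eval (\<lambda>p. Neg p \<in> set K) a"
    using assms eval_clause by blast
  then obtain p where p: "Pos p \<in> set K" "Neg p \<in> set K"
    by - (cases a, auto)
  have "derives TT (disj2 (Atom (Pos p)) (Bar (Atom (Pos p))))"
    by (rule derives_i_down)
  also have "eqv (disj2 (Atom (Pos p)) (Bar (Atom (Pos p)))) (disj2 (Atom (Pos p)) (Atom (Neg p)))"
    using eqv.neg_atom [of "Pos p"] by (simp add: eqv_disj2_cong_right)
  \<comment> \<open>Each of the two complementary atoms is weakened to a full copy of the clause;
    contraction then leaves one copy.\<close>
  also have "derives (disj2 (Atom (Pos p)) (Atom (Neg p))) (disj2 (clause K) (Atom (Neg p)))"
    using p(1) by (intro derives_disj2_left derives_Atom_clause)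
  also have "derives (disj2 (clause K) (Atom (Neg p))) (disj2 (clause K) (clause K))"
    using p(2) by (intro derives_disj2_right derives_Atom_clause)
  also have "derives (disj2 (clause K) (clause K)) (clause K)"
    by (rule derives_c_down)
  finally show ?thesis .
qed

text \<open>
  Taking all entailed clauses avoids computing a conjunctive normal form, and the side
  structure \<open>C\<close> lets disjunctions be treated one disjunct at a time.
\<close>

definition clausal :: "'v expr \<Rightarrow> bool" where
  "clausal A \<longleftrightarrow>
     (\<forall>C. (\<forall>K. (\<forall>v. eval v A \<longrightarrow> eval v (clause K)) \<longrightarrow> derives TT (disj2 (clause K) C))
        \<longrightarrow> derives TT (disj2 A C))"

lemma clausalI:
  assumes "\<And>C. (\<And>K. (\<And>v. eval v A \<Longrightarrow> eval v (clause K)) \<Longrightarrow> derives TT (disj2 (clause K) C))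
             \<Longrightarrow> derives TT (disj2 A C)"
  shows "clausal A"
  using assms unfolding clausal_def by blast

lemma clausalD:
  assumes "clausal A"
    and "\<And>K. (\<And>v. eval v A \<Longrightarrow> eval v (clause K)) \<Longrightarrow> derives TT (disj2 (clause K) C)"
  shows "derives TT (disj2 A C)"
  using assms unfolding clausal_def by blast

text \<open>The entailed clauses depend only on truth values, and derivability does not distinguish
  equivalent structures.\<close>

lemma clausal_eqv:
  assumes "eqv A B" "clausal B"
  shows "clausal A"
proof -
  have "eval v A = eval v B" for v by (rule eqv_imp_eval_eq [OF assms(1)])
  moreover have "derives (disj2 B C) (disj2 A C)" for C
    by (rule eqv_imp_derives [OF eqv_disj2_cong_left [OF eqv.sym [OF assms(1)]]])
  ultimately show ?thesis
    using assms(2) unfolding clausal_def by (metis derives_trans)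
qed

section \<open>Closure of clausal structures under the connectives\<close>

lemma clausal_TT: "clausal TT"
  by (rule clausalI) (rule derives_disj2_intro_left)

lemma clausal_FF: "clausal (FF :: 'v expr)"
proof (rule clausalI)
  fix C :: "'v expr"
  assume "\<And>K. (\<And>v. eval v FF \<Longrightarrow> eval v (clause K)) \<Longrightarrow> derives TT (disj2 (clause K) C)"
  from this [of "[]"] show "derives TT (disj2 FF C)" by simp
qed

lemma clausal_Atom: "clausal (Atom a :: 'v expr)"
proof (rule clausalI)
  fix C :: "'v expr"
  assume "\<And>K. (\<And>v. eval v (Atom a) \<Longrightarrow> eval v (clause K)) \<Longrightarrow> derives TT (disj2 (clause K) C)"
  from this [of "[a]"] have "derives TT (disj2 (disj2 (Atom a) FF) C)" by simp
  also have "eqv (disj2 (disj2 (Atom a) FF) C) (disj2 (Atom a) C)"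
    by (rule eqv_disj2_cong_left [OF eqv_disj2_FF_right])
  finally show "derives TT (disj2 (Atom a) C)" .
qed

text \<open>A clause entailed by one conjunct is entailed by the conjunction, so the assumption on
  \<open>C\<close> passes to both conjuncts. The two resulting proofs are joined by
  distributivity.\<close>

lemma clausal_conj2:
  assumes "clausal A" "clausal B"
  shows "clausal (conj2 A B)"
proof (rule clausalI)
  fix C
  assume C: "\<And>K. (\<And>v. eval v (conj2 A B) \<Longrightarrow> eval v (clause K)) \<Longrightarrow> derives TT (disj2 (clause K) C)"
  have "derives TT (disj2 A C)"
    by (rule clausalD [OF assms(1)], rule C) simp
  moreover have "derives TT (disj2 B C)"
    by (rule clausalD [OF assms(2)], rule C) simp
  ultimately show "derives TT (disj2 (conj2 A B) C)"
    by (meson derives_TT_conj2 derives_distrib derives_trans)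
qed

lemma clausal_disj2:
  assumes "clausal A" "clausal B"
  shows "clausal (disj2 A B)"
proof (rule clausalI)
  fix C
  assume C: "\<And>K. (\<And>v. eval v (disj2 A B) \<Longrightarrow> eval v (clause K)) \<Longrightarrow> derives TT (disj2 (clause K) C)"
  \<comment> \<open>The disjunct \<open>B\<close> is first absorbed into the side structure. When
    \<open>B\<close> is treated in turn, the clause \<open>K\<close> chosen for \<open>A\<close> is
    part of the side structure.\<close>
  have "derives TT (disj2 A (disj2 B C))"
  proof (rule clausalD [OF assms(1)])
    fix K
    assume K: "\<And>v. eval v A \<Longrightarrow> eval v (clause K)"
    have "derives TT (disj2 B (disj2 (clause K) C))"
    proof (rule clausalD [OF assms(2)])
      fix L
      assume L: "\<And>v. eval v B \<Longrightarrow> eval v (clause L)"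
      \<comment> \<open>A clause entailed by \<open>A\<close> together with one entailed by
        \<open>B\<close> forms a clause entailed by their disjunction.\<close>
      have "derives TT (disj2 (clause (L @ K)) C)"
        by (rule C) (use K L in \<open>auto simp: eval_clause\<close>)
      also have "eqv (disj2 (clause (L @ K)) C) (disj2 (disj2 (clause L) (clause K)) C)"
        by (rule eqv_disj2_cong_left [OF eqv_clause_append])
      also have "eqv (disj2 (disj2 (clause L) (clause K)) C) (disj2 (clause L) (disj2 (clause K) C))"
        by (rule eqv_disj2_assoc)
      finally show "derives TT (disj2 (clause L) (disj2 (clause K) C))" .
    qed
    also have "eqv (disj2 B (disj2 (clause K) C)) (disj2 (clause K) (disj2 B C))"
      by (rule eqv_disj2_left_commute)
    finally show "derives TT (disj2 (clause K) (disj2 B C))" .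
  qed
  also have "eqv (disj2 A (disj2 B C)) (disj2 (disj2 A B) C)"
    by (rule eqv.sym [OF eqv_disj2_assoc])
  finally show "derives TT (disj2 (disj2 A B) C)" .
qed

text \<open>De Morgan's law is given for two disjuncts only, so longer lists are split at the head.
  The negated half of the claim then reduces to a conjunction of negations.\<close>

lemma clausal_Disj:
  assumes "clausal A \<and> clausal (Bar A)" "\<And>B. B \<in> set Bs \<Longrightarrow> clausal B \<and> clausal (Bar B)"
  shows "clausal (Disj A Bs) \<and> clausal (Bar (Disj A Bs))"
  using assms
proof (induction Bs arbitrary: A)
  case Nil
  then show ?case by (meson clausal_eqv eqv.cong_neg eqv_Disj_Nil)
next
  case (Cons B Bs)
  then have IH: "clausal (Disj B Bs)" "clausal (Bar (Disj B Bs))" by simp_all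
  have "eqv (Bar (Disj A (B # Bs))) (Bar (disj2 A (Disj B Bs)))"
    by (rule eqv.cong_neg [OF eqv_Disj_Cons])
  also have "eqv (Bar (disj2 A (Disj B Bs))) (conj2 (Bar A) (Bar (Disj B Bs)))"
    using eqv.neg_disj by simp
  finally have "clausal (Bar (Disj A (B # Bs)))"
    using clausal_eqv clausal_conj2 Cons.prems(1) IH(2) by blast
  moreover have "clausal (Disj A (B # Bs))"
    using clausal_eqv [OF eqv_Disj_Cons] clausal_disj2 Cons.prems(1) IH(1) by blast
  ultimately show ?case by blast
qed

lemma clausal_Conj:
  assumes "clausal A \<and> clausal (Bar A)" "\<And>B. B \<in> set Bs \<Longrightarrow> clausal B \<and> clausal (Bar B)"
  shows "clausal (Conj A Bs) \<and> clausal (Bar (Conj A Bs))"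
  using assms
proof (induction Bs arbitrary: A)
  case Nil
  then show ?case by (meson clausal_eqv eqv.cong_neg eqv_Conj_Nil)
next
  case (Cons B Bs)
  then have IH: "clausal (Conj B Bs)" "clausal (Bar (Conj B Bs))" by simp_all
  have "eqv (Bar (Conj A (B # Bs))) (Bar (conj2 A (Conj B Bs)))"
    by (rule eqv.cong_neg [OF eqv_Conj_Cons])
  also have "eqv (Bar (conj2 A (Conj B Bs))) (disj2 (Bar A) (Bar (Conj B Bs)))"
    using eqv.neg_conj by simp
  finally have "clausal (Bar (Conj A (B # Bs)))"
    using clausal_eqv clausal_disj2 Cons.prems(1) IH(2) by blast
  moreover have "clausal (Conj A (B # Bs))"
    using clausal_eqv [OF eqv_Conj_Cons] clausal_conj2 Cons.prems(1) IH(1) by blast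
  ultimately show ?case by blast
qed

text \<open>Carrying the negation along makes the induction pass through \<open>Bar\<close>: the
  claim for \<open>Bar (Bar A)\<close> follows from that for \<open>A\<close> by double
  negation.\<close>

lemma clausal_expr: "clausal A \<and> clausal (Bar A)"
proof (induction A)
  case FF
  then show ?case using clausal_FF clausal_eqv [OF eqv.neg_FF clausal_TT] by blast
next
  case TT
  then show ?case using clausal_TT clausal_eqv [OF eqv.neg_TT clausal_FF] by blast
next
  case (Atom a)
  then show ?case using clausal_Atom clausal_eqv [OF eqv.neg_atom clausal_Atom] by blast
next
  case (Disj A Bs)
  then show ?case by (intro clausal_Disj)
next
  case (Conj A Bs)
  then show ?case by (intro clausal_Conj)
next
  case (Bar A)
  then show ?case using clausal_eqv [OF eqv.neg_neg] by blast
qed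

lemma derives_TT_valid:
  assumes "\<And>v. eval v A"
  shows "derives TT A"
proof -
  \<comment> \<open>With \<open>FF\<close> as side structure, only provability of the entailed
    clauses remains, and every clause entailed by a valid structure is itself valid.\<close>
  have "derives TT (disj2 A FF)"
  proof (rule clausalD)
    show "clausal A" using clausal_expr by blast
    fix K
    assume "\<And>v. eval v A \<Longrightarrow> eval v (clause K)"
    with assms have "derives TT (clause K)" by (intro derives_TT_clause) blast
    then show "derives TT (disj2 (clause K) FF)"
      by (rule derives_trans [OF _ derives_disj2_intro_left])
  qed
  then show ?thesis by (rule derives_eqv_trans [OF _ eqv_disj2_FF_right])
qed

lemma KSg_complete:
  assumes "\<And>v. struct_eval v R"
  shows "\<exists>D. proof_of KSg D R"
proof -
  obtain A where A: "R = cls A" by (metis Quotient_abs_rep Quotient_struct)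
  with assms have "derives TT A" by (intro derives_TT_valid) (simp add: struct_eval.abs_eq)
  \<comment> \<open>The empty context recovers an actual proof from derivability in all
    contexts.\<close>
  then have "(cls (fill Hole TT), cls (fill Hole A)) \<in> (\<Union>KSg)\<^sup>*"
    unfolding derives_def by blast
  then show ?thesis
    using derivation_of_rtrancl A unfolding proof_of_def by fastforce
qed

text \<open>The given proof is used only to see that its conclusion is valid; completeness then
  supplies a new proof, unrelated to the old one.\<close>

lemma sound_imp_admissible:
  assumes "sound \<rho>"
  shows "admissible \<rho> KSg"
  unfolding admissible_def
proof (intro allI impI)
  fix D R
  assume D: "proof_of (KSg \<union> {\<rho>}) D R"
  have "struct_eval v R" for v
  proof -
    have "struct_eval v (hd D)" using D by (simp add: proof_of_def struct_eval.abs_eq)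
    with D have "struct_eval v (last D)"
      using derivation_sound [of "KSg \<union> {\<rho>}"] sound_KSg assms unfolding proof_of_def by blast
    with D show ?thesis by (simp add: proof_of_def)
  qed
  then show "\<exists>D'. proof_of KSg D' R" by (rule KSg_complete)
qed

theorem theorem3p16:
  shows "admissible (i_up :: 'v rule) KSg \<and> admissible (w_up :: 'v rule) KSg \<and> admissible (c_up :: 'v rule) KSg"
  by (intro conjI sound_imp_admissible sound_up)

end
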